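(* Let $n\ge 2$ and $1\le k\le n-1$. The number of ordered pairs $(\sigma,\tau)$ of $n$-cycles on $[n]=\{1,\ldots,n\}$ such that no cycle of the product $\sigma\tau$ contains both an element of $[k]$ and an element of $[n]\setminus[k]$ equals $k!\,(n-k)!\,(n-2)!$. More generally, let $\alpha=(\alpha_1,\ldots,\alpha_k)$ be an integer composition of $n$ (i.e. $\alpha_t>0$ and $\sum_t\alpha_t=n$). Then the number of ordered pairs $(\sigma,\tau)$ of $n$-cycles on $[n]$ whose product $\sigma\tau$ is $\alpha$-separated equals $$\frac{(n-1)!}{n+1-k}\prod_{t=1}^k \alpha_t!\,.$$
   Context: For a composition $\alpha=(\alpha_1,\ldots,\alpha_k)$ of $n$, set $\alpha_0=0$ and $B_i=\{\sum_{j=0}^{i-1}\alpha_j+1,\ldots,\sum_{j=0}^{i-1}\alpha_j+\alpha_i\}$ for $1\le i\le k$. A permutation $\pi$ on $[n]$ is called $\alpha$-separated if every cycle of $\pi$ has all its elements in a single block $B_i$. An $n$-cycle on $[n]$ is a permutation consisting of a single cycle of length $n$. *)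

theory Defs
  imports Complex_Main "HOL-Combinatorics.Combinatorics"
begin

definition is_composition :: "nat list \<Rightarrow> nat \<Rightarrow> bool" where
  "is_composition \<alpha> n \<longleftrightarrow> (\<forall>a\<in>set \<alpha>. 0 < a) \<and> sum_list \<alpha> = n"

(* The parts are alpha ! 0, ..., alpha ! (k-1), so block alpha i is the set B_{i+1}. *)
definition block :: "nat list \<Rightarrow> nat \<Rightarrow> nat set" where
  "block \<alpha> i = {sum_list (take i \<alpha>) + 1 .. sum_list (take i \<alpha>) + \<alpha> ! i}"

(* The cycles of a permutation of [n], as sets of elements; the fixed points are
   the singleton cycles. *)
definition cycle_sets :: "nat \<Rightarrow> (nat \<Rightarrow> nat) \<Rightarrow> nat set set" where
  "cycle_sets n \<pi> = orbit \<pi> ` {1..n}"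

definition separated :: "nat \<Rightarrow> nat list \<Rightarrow> (nat \<Rightarrow> nat) \<Rightarrow> bool" where
  "separated n \<alpha> \<pi> \<longleftrightarrow> (\<forall>C\<in>cycle_sets n \<pi>. \<exists>i<length \<alpha>. C \<subseteq> block \<alpha> i)"

definition full_cycle :: "nat \<Rightarrow> (nat \<Rightarrow> nat) \<Rightarrow> bool" where
  "full_cycle n \<sigma> \<longleftrightarrow> \<sigma> permutes {1..n} \<and> cyclic_on \<sigma> {1..n}"

end

theory Submission
  imports Defs
begin

text \<open>
  Let \<open>N(w)\<close> be the number of factorisations of \<open>w\<close> into two \<open>n\<close>-cycles, and write \<open>w \<setminus> x\<close> for \<open>w\<close> with
  the point \<open>x\<close> cut out of its cycle. For odd \<open>w\<close> on \<open>n + 1\<close> points, the sum of \<open>N(w \<setminus> x)\<close> over the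
  nonfixed points \<open>x\<close> of \<open>w\<close> is \<open>2 (n - 1)!\<close>, independently of \<open>w\<close>; this follows by induction from
  the recursion that removes one point from both cycles. Let \<open>F(\<beta>)\<close> be the sum of \<open>N\<close> over the Young
  subgroup of a composition \<open>\<beta>\<close>, and \<open>e\<^sub>i\<close> the \<open>i\<close>-th unit vector. Summing over the odd elements
  of the Young subgroup of a composition \<open>\<beta>\<close> of \<open>n + 1\<close> with some part at least 2 gives
  \<open>\<Sum>\<^sub>i \<beta>\<^sub>i (\<beta>\<^sub>i - 1) F(\<beta> - e\<^sub>i) = (n - 1)! \<Prod>\<^sub>i \<beta>\<^sub>i!\<close>.
  Taking \<open>\<beta> = \<alpha> + e\<^sub>1\<close>, this determines \<open>F(\<alpha>)\<close> by induction on the total size of the other parts.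
  Compositions are replaced by arbitrary colourings \<open>f\<close> of a finite set.
\<close>

subsection \<open>Factorisations into two full cycles\<close>

text \<open>An arbitrary set takes the place of [n], because the inductions delete points one at a
  time.\<close>

definition ncycle :: "'a set \<Rightarrow> ('a \<Rightarrow> 'a) \<Rightarrow> bool" where
  "ncycle S \<sigma> \<longleftrightarrow> \<sigma> permutes S \<and> cyclic_on \<sigma> S"

text \<open>Removes the point \<open>y\<close> from its cycle, turning it into a fixed point.\<close>
definition del :: "'a \<Rightarrow> ('a \<Rightarrow> 'a) \<Rightarrow> 'a \<Rightarrow> 'a" where
  "del y u = transpose y (u y) \<circ> u"

text \<open>The substitution \<open>\<sigma>\<^sup>-\<^sup>1 \<circ> (\<sigma> \<circ> w) = w\<close> shows that this is the number of factorisations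
  of \<open>w\<close> into two full cycles on \<open>S\<close>.\<close>
definition nfact :: "'a set \<Rightarrow> ('a \<Rightarrow> 'a) \<Rightarrow> nat" where
  "nfact S w = card {\<sigma>. ncycle S \<sigma> \<and> ncycle S (\<sigma> \<circ> w)}"

text \<open>Every orbit is a closed set, and it lies in each closed set that contains its base
  point. So a single cycle means that no proper nonempty subset is closed, a form that transfers
  easily to deletions and conjugates.\<close>

lemma ncycle_iff_closed:
  assumes "finite S" "S \<noteq> {}"
  shows "ncycle S \<sigma> \<longleftrightarrow> \<sigma> permutes S \<and> (\<forall>A. A \<subseteq> S \<and> A \<noteq> {} \<and> \<sigma> ` A \<subseteq> A \<longrightarrow> A = S)"
proof (cases "\<sigma> permutes S")
  case True
  have orb: "orbit \<sigma> x \<subseteq> A" if "x \<in> A" "\<sigma> ` A \<subseteq> A" for x A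
  proof
    fix z assume "z \<in> orbit \<sigma> x" then show "z \<in> A"
      by induction (use that in auto)
  qed
  \<comment> \<open>\<open>orbit\<close> is generated from the image of its base point, so
    membership of the base point itself comes from finiteness.\<close>
  have self: "x \<in> orbit \<sigma> x" for x
    using True assms(1) by (meson permutation_permutes permutation_self_in_orbit)
  have cl: "\<sigma> ` orbit \<sigma> x \<subseteq> orbit \<sigma> x" for x by (auto intro: orbit.intros)
  have "cyclic_on \<sigma> S \<longleftrightarrow> (\<forall>A. A \<subseteq> S \<and> A \<noteq> {} \<and> \<sigma> ` A \<subseteq> A \<longrightarrow> A = S)"
  proof
    assume "cyclic_on \<sigma> S"
    then show "\<forall>A. A \<subseteq> S \<and> A \<noteq> {} \<and> \<sigma> ` A \<subseteq> A \<longrightarrow> A = S"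
      using orb unfolding cyclic_on_alldef by (metis subset_antisym ex_in_conv subsetD)
  next
    assume R: "\<forall>A. A \<subseteq> S \<and> A \<noteq> {} \<and> \<sigma> ` A \<subseteq> A \<longrightarrow> A = S"
    have im: "\<sigma> ` S \<subseteq> S" using True by (simp add: permutes_image)
    have "orbit \<sigma> x = S" if "x \<in> S" for x
      using R orb[OF that im] cl[of x] self[of x] by blast
    then show "cyclic_on \<sigma> S" using assms(2) unfolding cyclic_on_alldef by auto
  qed
  then show ?thesis using True by (simp add: ncycle_def)
qed (simp add: ncycle_def)

lemma ncycle_permutes: "ncycle S \<sigma> \<Longrightarrow> \<sigma> permutes S"
  by (simp add: ncycle_def)

lemma ncycle_no_fixpoint:
  assumes "ncycle S \<sigma>" "y \<in> S" "S - {y} \<noteq> {}"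
  shows "\<sigma> y \<noteq> y"
  using assms unfolding ncycle_def cyclic_on_alldef by (metis Diff_cancel orbit_eq_singleton_iff)

lemma del_self [simp]: "del y u y = y"
  by (simp add: del_def)

lemma del_other: "inj u \<Longrightarrow> x \<noteq> y \<Longrightarrow> del y u x = (if u x = y then u y else u x)"
  by (auto simp: del_def transpose_def inj_eq)

lemma del_permutes:
  assumes "u permutes S" "y \<in> S"
  shows "del y u permutes (S - {y})"
proof -
  have "del y u permutes S" unfolding del_def
    using assms by (intro permutes_compose permutes_swap_id) (auto simp: permutes_in_image)
  then show ?thesis by (rule permutes_superset) auto
qed

text \<open>Closed sets of \<open>\<sigma>\<close> and of \<open>del y \<sigma>\<close> correspond
  by dropping or restoring \<open>y\<close>. A fixed \<open>y\<close> is excluded: its deletion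
  would lose a whole cycle.\<close>

lemma ncycle_del_iff:
  assumes "finite S" "y \<in> S" "\<sigma> permutes S" "\<sigma> y \<noteq> y"
  shows "ncycle S \<sigma> \<longleftrightarrow> ncycle (S - {y}) (del y \<sigma>)"
proof -
  have inj: "inj \<sigma>" using assms(3) by (rule permutes_inj)
  obtain p where p: "\<sigma> p = y" "p \<in> S" "p \<noteq> y"
    by (metis assms(2,3,4) permutes_imp_bij bij_betw_iff_bijections)
  have ne: "S - {y} \<noteq> {}" using p by auto
  note d = del_other[OF inj]
  have dp: "del y \<sigma> p = \<sigma> y" using d p by simp
  have dn: "del y \<sigma> x = \<sigma> x" if "x \<noteq> y" "x \<noteq> p" for x
    using that d p inj by (metis injD)
  show ?thesis
    unfolding ncycle_iff_closed[OF assms(1) ex_in_conv[THEN iffD1, OF exI, OF assms(2)]]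
      ncycle_iff_closed[OF finite_Diff[OF assms(1)] ne]
  proof (intro conj_cong iffI allI impI)
    show "\<sigma> permutes S" by fact
    show "del y \<sigma> permutes (S - {y})" by (rule del_permutes[OF assms(3,2)])
  next
    fix A
    assume R: "\<forall>A. A \<subseteq> S \<and> A \<noteq> {} \<and> \<sigma> ` A \<subseteq> A \<longrightarrow> A = S"
      and A: "A \<subseteq> S - {y} \<and> A \<noteq> {} \<and> del y \<sigma> ` A \<subseteq> A"
    \<comment> \<open>A set closed under \<open>\<sigma>\<close> that contains the predecessor
      \<open>p\<close> of \<open>y\<close> must contain \<open>y\<close>; adding \<open>y\<close>
      exactly then makes \<open>A\<close> closed under \<open>\<sigma>\<close>.\<close>
    define A' where "A' = (if p \<in> A then insert y A else A)"
    have "\<sigma> x \<in> A'" if "x \<in> A'" for x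
    proof (cases "x = p")
      case True then show ?thesis using that p by (auto simp: A'_def split: if_splits)
    next
      case xp: False
      show ?thesis
      proof (cases "x = y")
        case True
        then have "p \<in> A" using that A by (auto simp: A'_def split: if_splits)
        then show ?thesis using True A dp by (auto simp: A'_def)
      next
        case False
        then have "x \<in> A" using that by (auto simp: A'_def split: if_splits)
        then show ?thesis using A dn[OF False xp] by (force simp: A'_def)
      qed
    qed
    then have "\<sigma> ` A' \<subseteq> A'" by blast
    moreover have "A' \<subseteq> S" "A' \<noteq> {}" using A assms(2) by (auto simp: A'_def)
    ultimately have "A' = S" using R by blast
    then have "A' - {y} = S - {y}" by simp
    moreover have "A' - {y} = A" using A by (auto simp: A'_def)
    ultimately show "A = S - {y}" by simp
  next
    fix A
    assume R: "\<forall>A. A \<subseteq> S - {y} \<and> A \<noteq> {} \<and> del y \<sigma> ` A \<subseteq> A \<longrightarrow> A = S - {y}"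
      and A: "A \<subseteq> S \<and> A \<noteq> {} \<and> \<sigma> ` A \<subseteq> A"
    have "A - {y} \<noteq> {}" using A assms(4) by blast
    moreover have "del y \<sigma> x \<in> A - {y}" if "x \<in> A - {y}" for x
    proof (cases "x = p")
      case True
      then have "y \<in> A" using that A p by auto
      then show ?thesis using True dp A assms(4) by auto
    next
      case False
      then have "\<sigma> x \<noteq> y" using p inj by (metis injD)
      then show ?thesis using that False dn[of x] A by auto
    qed
    ultimately have "A - {y} = S - {y}" using R A by (meson Diff_mono image_subsetI order_refl)
    then have "p \<in> A" using p by auto
    then have "y \<in> A" using A p by auto
    then show "A = S" using \<open>A - {y} = S - {y}\<close> assms(2) by blast
  qed
qed

lemma inj_comp_transpose:
  assumes "inj g"
  shows "g \<circ> transpose a b = transpose (g a) (g b) \<circ> g"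
  using assms by (auto simp: fun_eq_iff transpose_def inj_eq)

text \<open>Moving \<open>g\<close> past the transposition of \<open>y\<close> and
  \<open>u y\<close> turns it into the one of \<open>y\<close> and \<open>g (u y)\<close>, as
  \<open>g\<close> fixes \<open>y\<close>.\<close>

lemma del_comp_left:
  assumes "inj g" "g y = y"
  shows "del y (g \<circ> u) = g \<circ> del y u"
proof -
  have "g \<circ> del y u = (g \<circ> transpose y (u y)) \<circ> u" by (simp add: del_def comp_assoc)
  also have "\<dots> = del y (g \<circ> u)"
    by (simp add: inj_comp_transpose[OF assms(1)] assms(2) del_def comp_assoc)
  finally show ?thesis by simp
qed

lemma finite_ncycles [simp]: "finite S \<Longrightarrow> finite {\<sigma>. ncycle S \<sigma> \<and> P \<sigma>}"
  by (rule finite_subset[OF _ finite_permutations[of S]]) (auto simp: ncycle_def)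

text \<open>A full cycle on \<open>S\<close> arises from one on \<open>S - {y}\<close> by inserting \<open>y\<close> directly after some
  point \<open>z\<close>; the choice \<open>z = w y\<close> would make \<open>y\<close> a fixed point of \<open>\<sigma> \<circ> w\<close>.\<close>
lemma nfact_rec:
  assumes "finite S" "y \<in> S" "S - {y} \<noteq> {}" "w permutes S"
  shows "nfact S w = (\<Sum>z\<in>S - {y, w y}. nfact (S - {y}) (del y (transpose z y \<circ> w)))"
proof -
  \<comment> \<open>Here \<open>\<rho>\<close> is \<open>\<sigma>\<close> with \<open>y\<close> cut
    out and \<open>z\<close> is the former predecessor of \<open>y\<close>, so that
    \<open>\<sigma> = \<rho> \<circ> transpose z y\<close> and the second cycle
    \<open>\<sigma> \<circ> w\<close> is expressed through \<open>\<rho>\<close>.\<close>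
  define B where "B z = {\<rho>. ncycle (S - {y}) \<rho> \<and> ncycle S (\<rho> \<circ> (transpose z y \<circ> w))}" for z
  have del_inv: "del y \<sigma> = \<sigma> \<circ> transpose (inv \<sigma> y) y" if "\<sigma> permutes S" for \<sigma>
    using inj_comp_transpose[OF permutes_inj[OF that], of "inv \<sigma> y" y]
    by (simp add: del_def permutes_inverses[OF that])
  have "bij_betw (\<lambda>\<sigma>. (inv \<sigma> y, del y \<sigma>)) {\<sigma>. ncycle S \<sigma> \<and> ncycle S (\<sigma> \<circ> w)} (Sigma (S - {y}) B)"
  proof (rule bij_betwI[where g = "\<lambda>(z, \<rho>). \<rho> \<circ> transpose z y"])
    show "(\<lambda>\<sigma>. (inv \<sigma> y, del y \<sigma>)) \<in> {\<sigma>. ncycle S \<sigma> \<and> ncycle S (\<sigma> \<circ> w)} \<rightarrow> Sigma (S - {y}) B"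
    proof
      fix \<sigma> assume "\<sigma> \<in> {\<sigma>. ncycle S \<sigma> \<and> ncycle S (\<sigma> \<circ> w)}"
      then have \<sigma>: "ncycle S \<sigma>" "ncycle S (\<sigma> \<circ> w)" by auto
      note per = ncycle_permutes[OF \<sigma>(1)]
      have nf: "\<sigma> y \<noteq> y" using ncycle_no_fixpoint[OF \<sigma>(1) assms(2,3)] .
      have "inv \<sigma> y \<in> S" using per assms(2) by (simp add: permutes_in_image permutes_inv)
      moreover have "inv \<sigma> y \<noteq> y" using nf per by (metis permutes_inverses(1))
      moreover have "ncycle (S - {y}) (del y \<sigma>)" using ncycle_del_iff[OF assms(1,2) per nf] \<sigma> by simp
      moreover have "del y \<sigma> \<circ> (transpose (inv \<sigma> y) y \<circ> w) = \<sigma> \<circ> w"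
        by (simp add: del_inv[OF per] fun_eq_iff)
      ultimately show "(inv \<sigma> y, del y \<sigma>) \<in> Sigma (S - {y}) B" using \<sigma> by (simp add: B_def)
    qed
    \<comment> \<open>Composing with \<open>transpose z y\<close> on the right sends
      \<open>z\<close> to \<open>y\<close> and \<open>y\<close> to \<open>\<rho> z\<close>; this
      inserts \<open>y\<close> after \<open>z\<close>.\<close>
    have ins: "(\<rho> \<circ> transpose z y) permutes S" "inv (\<rho> \<circ> transpose z y) y = z"
        "del y (\<rho> \<circ> transpose z y) = \<rho>" "(\<rho> \<circ> transpose z y) y \<noteq> y"
      if z: "z \<in> S - {y}" and r: "\<rho> permutes (S - {y})" for z \<rho>
    proof -
      have r': "\<rho> permutes S" by (rule permutes_subset[OF r]) auto
      have ry: "\<rho> y = y" using r by (simp add: permutes_not_in)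
      show p: "(\<rho> \<circ> transpose z y) permutes S"
        using z assms(2) by (intro permutes_compose permutes_swap_id r') auto
      have "(\<rho> \<circ> transpose z y) z = y" using ry by simp
      then show i: "inv (\<rho> \<circ> transpose z y) y = z" using p by (metis permutes_inverses(2))
      show "del y (\<rho> \<circ> transpose z y) = \<rho>" using del_inv[OF p] i by (simp add: fun_eq_iff)
      show "(\<rho> \<circ> transpose z y) y \<noteq> y" using ry z permutes_inj[OF r] by (simp, metis injD)
    qed
    show "(\<lambda>(z, \<rho>). \<rho> \<circ> transpose z y) \<in> Sigma (S - {y}) B \<rightarrow> {\<sigma>. ncycle S \<sigma> \<and> ncycle S (\<sigma> \<circ> w)}"
    proof
      fix zr assume "zr \<in> Sigma (S - {y}) B"
      then obtain z \<rho> where zr: "z \<in> S - {y}" "\<rho> \<in> B z" "zr = (z, \<rho>)" by blast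
      then have r: "ncycle (S - {y}) \<rho>" "ncycle S (\<rho> \<circ> (transpose z y \<circ> w))" by (auto simp: B_def)
      note b = ins[of z \<rho>] ncycle_permutes[OF r(1)]
      have "ncycle S (\<rho> \<circ> transpose z y)"
        using ncycle_del_iff[OF assms(1,2), of "\<rho> \<circ> transpose z y"] b zr r by simp
      moreover have "ncycle S (\<rho> \<circ> transpose z y \<circ> w)" using r by (simp add: comp_assoc)
      ultimately show "(case zr of (z, \<rho>) \<Rightarrow> \<rho> \<circ> transpose z y)
          \<in> {\<sigma>. ncycle S \<sigma> \<and> ncycle S (\<sigma> \<circ> w)}" using zr by simp
    qed
    show "(case (inv \<sigma> y, del y \<sigma>) of (z, \<rho>) \<Rightarrow> \<rho> \<circ> transpose z y) = \<sigma>"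
      if "\<sigma> \<in> {\<sigma>. ncycle S \<sigma> \<and> ncycle S (\<sigma> \<circ> w)}" for \<sigma>
      using that del_inv[OF ncycle_permutes] by (auto simp: fun_eq_iff)
    show "(\<lambda>\<sigma>. (inv \<sigma> y, del y \<sigma>)) (case zr of (z, \<rho>) \<Rightarrow> \<rho> \<circ> transpose z y) = zr"
      if "zr \<in> Sigma (S - {y}) B" for zr
      using that ins[of "fst zr" "snd zr"] by (cases zr) (auto simp: B_def ncycle_def)
  qed
  then have "nfact S w = card (Sigma (S - {y}) B)"
    unfolding nfact_def by (rule bij_betw_same_card)
  also have "\<dots> = (\<Sum>z\<in>S - {y}. card (B z))"
    using assms(1) by (intro card_SigmaI) (auto simp: B_def)
  also have "\<dots> = (\<Sum>z\<in>S - {y, w y}. card (B z))"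
  proof (rule sum.mono_neutral_right)
    show "finite (S - {y})" using assms(1) by simp
    show "\<forall>z\<in>S - {y} - (S - {y, w y}). card (B z) = 0"
    proof
      fix z assume z: "z \<in> S - {y} - (S - {y, w y})"
      have "B z = {}"
      proof (rule ccontr)
        assume "B z \<noteq> {}"
        then obtain \<rho> where r: "ncycle (S - {y}) \<rho>" "ncycle S (\<rho> \<circ> (transpose z y \<circ> w))"
          by (auto simp: B_def)
        have "\<rho> y = y" using ncycle_permutes[OF r(1)] by (simp add: permutes_not_in)
        then have "(\<rho> \<circ> (transpose z y \<circ> w)) y = y" using z by auto
        then show False using ncycle_no_fixpoint[OF r(2) assms(2,3)] by simp
      qed
      then show "card (B z) = 0" by simp
    qed
  qed auto
  also have "\<dots> = (\<Sum>z\<in>S - {y, w y}. nfact (S - {y}) (del y (transpose z y \<circ> w)))"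
  proof (rule sum.cong[OF refl])
    fix z assume z: "z \<in> S - {y, w y}"
    define u where "u = transpose z y \<circ> w"
    have up: "u permutes S" unfolding u_def
      using z assms by (intro permutes_compose permutes_swap_id) auto
    have uy: "u y \<noteq> y" using z by (auto simp: u_def transpose_def)
    \<comment> \<open>Since \<open>\<rho>\<close> fixes \<open>y\<close> and \<open>u\<close> does
      not, the product moves \<open>y\<close>; hence \<open>y\<close> may be deleted, and the
      deletion passes through \<open>\<rho>\<close> to \<open>u\<close>.\<close>
    have "ncycle S (\<rho> \<circ> u) \<longleftrightarrow> ncycle (S - {y}) (\<rho> \<circ> del y u)" if r: "ncycle (S - {y}) \<rho>" for \<rho>
    proof -
      have r': "\<rho> permutes (S - {y})" by (rule ncycle_permutes[OF r])
      then have r'': "\<rho> permutes S" by (rule permutes_subset) auto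
      have ry: "\<rho> y = y" using r' by (simp add: permutes_not_in)
      have "(\<rho> \<circ> u) y \<noteq> y" using ry uy permutes_inj[OF r'] by (simp, metis injD)
      then show ?thesis
        using ncycle_del_iff[OF assms(1,2) permutes_compose[OF up r'']]
          del_comp_left[OF permutes_inj[OF r'] ry] by simp
    qed
    then show "card (B z) = nfact (S - {y}) (del y (transpose z y \<circ> w))"
      unfolding B_def nfact_def u_def[symmetric] by (metis (mono_tags, lifting))
  qed
  finally show ?thesis .
qed

section \<open>Inversion and conjugation of factorisations\<close>

lemma nfact_inv:
  assumes "w permutes S"
  shows "nfact S (inv w) = nfact S w"
proof -
  \<comment> \<open>The two full cycles \<open>\<sigma>\<close> and
    \<open>\<sigma> \<circ> w\<close> exchange roles.\<close>
  have "bij_betw (\<lambda>\<sigma>. \<sigma> \<circ> w) {\<sigma>. ncycle S \<sigma> \<and> ncycle S (\<sigma> \<circ> w)}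
          {\<sigma>. ncycle S \<sigma> \<and> ncycle S (\<sigma> \<circ> inv w)}"
    by (rule bij_betwI[where g = "\<lambda>\<sigma>. \<sigma> \<circ> inv w"])
      (auto simp: comp_assoc permutes_inv_o[OF assms])
  then show ?thesis unfolding nfact_def by (rule bij_betw_same_card[symmetric])
qed

text \<open>The transposition may exchange a point of \<open>S\<close> with one outside, hence the
  image set. Closed sets are carried along by the relabelling.\<close>

lemma ncycle_conj:
  assumes "finite S" "ncycle S \<sigma>"
  shows "ncycle (transpose a b ` S) (transpose a b \<circ> \<sigma> \<circ> transpose a b)"
proof (cases "S = {}")
  case True then show ?thesis using assms by (auto simp: ncycle_def cyclic_on_def)
next
  case False
  let ?t = "transpose a b"
  have per: "\<sigma> permutes S" using assms ncycle_permutes by auto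
  have "?t \<circ> \<sigma> \<circ> ?t permutes ?t ` S"
  proof (rule bij_imp_permutes)
    have "bij_betw \<sigma> S S" using per by (rule permutes_imp_bij)
    moreover have "bij_betw ?t S (?t ` S)" "bij_betw ?t (?t ` S) S"
      by (auto simp: bij_betw_def image_image)
    ultimately show "bij_betw (?t \<circ> \<sigma> \<circ> ?t) (?t ` S) (?t ` S)"
      by (meson bij_betw_trans)
    show "(?t \<circ> \<sigma> \<circ> ?t) x = x" if "x \<notin> ?t ` S" for x
      using that per by (metis comp_apply image_eqI permutes_not_in transpose_involutory)
  qed
  moreover have "A = ?t ` S" if A: "A \<subseteq> ?t ` S" "A \<noteq> {}" "(?t \<circ> \<sigma> \<circ> ?t) ` A \<subseteq> A" for A
  proof -
    have "?t ` A \<subseteq> S" using A(1) by (auto simp: image_subset_iff)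
    moreover have "\<sigma> ` ?t ` A \<subseteq> ?t ` A"
      using A(3) by (auto simp: image_subset_iff) (metis image_eqI transpose_involutory)
    ultimately have "?t ` A = S"
      using assms False A(2) by (simp add: ncycle_iff_closed)
    then show ?thesis by (auto simp: image_image)
  qed
  ultimately show ?thesis using assms(1) False by (simp add: ncycle_iff_closed)
qed

lemma conj_transpose_twice: "transpose a b \<circ> (transpose a b \<circ> u \<circ> transpose a b) \<circ> transpose a b = u"
  by (simp add: fun_eq_iff)

lemma ncycle_conj_iff:
  assumes "finite S"
  shows "ncycle (transpose a b ` S) (transpose a b \<circ> \<sigma> \<circ> transpose a b) \<longleftrightarrow> ncycle S \<sigma>"
  using ncycle_conj[OF assms] ncycle_conj[of "transpose a b ` S" "transpose a b \<circ> \<sigma> \<circ> transpose a b" a b] assms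
  by (auto simp only: image_image transpose_involutory image_ident conj_transpose_twice finite_imageI)

text \<open>Conjugation respects composition. Its use is to compare the deletions of two different
  points, which live on different sets.\<close>

lemma nfact_conj:
  assumes "finite S"
  shows "nfact (transpose a b ` S) (transpose a b \<circ> w \<circ> transpose a b) = nfact S w"
proof -
  let ?t = "transpose a b"
  have cc: "?t \<circ> \<sigma> \<circ> ?t \<circ> (?t \<circ> w \<circ> ?t) = ?t \<circ> (\<sigma> \<circ> w) \<circ> ?t" for \<sigma>
    by (simp add: fun_eq_iff)
  have "bij_betw (\<lambda>\<sigma>. ?t \<circ> \<sigma> \<circ> ?t) {\<sigma>. ncycle S \<sigma> \<and> ncycle S (\<sigma> \<circ> w)}
      {\<sigma>. ncycle (?t ` S) \<sigma> \<and> ncycle (?t ` S) (\<sigma> \<circ> (?t \<circ> w \<circ> ?t))}"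
  proof (rule bij_betwI[where g = "\<lambda>\<sigma>. ?t \<circ> \<sigma> \<circ> ?t"])
    show "(\<lambda>\<sigma>. ?t \<circ> \<sigma> \<circ> ?t) \<in> {\<sigma>. ncycle S \<sigma> \<and> ncycle S (\<sigma> \<circ> w)} \<rightarrow>
      {\<sigma>. ncycle (?t ` S) \<sigma> \<and> ncycle (?t ` S) (\<sigma> \<circ> (?t \<circ> w \<circ> ?t))}"
      by (auto simp only: Pi_iff mem_Collect_eq cc ncycle_conj_iff[OF assms])
    show "(\<lambda>\<sigma>. ?t \<circ> \<sigma> \<circ> ?t) \<in> {\<sigma>. ncycle (?t ` S) \<sigma> \<and> ncycle (?t ` S) (\<sigma> \<circ> (?t \<circ> w \<circ> ?t))} \<rightarrow>
      {\<sigma>. ncycle S \<sigma> \<and> ncycle S (\<sigma> \<circ> w)}"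
    proof
      fix \<sigma> assume s: "\<sigma> \<in> {\<sigma>. ncycle (?t ` S) \<sigma> \<and> ncycle (?t ` S) (\<sigma> \<circ> (?t \<circ> w \<circ> ?t))}"
      obtain \<tau> where \<tau>: "\<sigma> = ?t \<circ> \<tau> \<circ> ?t" using conj_transpose_twice[of a b \<sigma>] by metis
      show "?t \<circ> \<sigma> \<circ> ?t \<in> {\<sigma>. ncycle S \<sigma> \<and> ncycle S (\<sigma> \<circ> w)}"
        using s unfolding \<tau> mem_Collect_eq cc ncycle_conj_iff[OF assms] conj_transpose_twice .
    qed
  qed (simp_all only: conj_transpose_twice)
  then show ?thesis unfolding nfact_def by (rule bij_betw_same_card[symmetric])
qed

subsection \<open>Removing a point from an odd permutation\<close>

lemma evenperm_transpose_comp: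
  assumes "finite S" "w permutes S" "a \<noteq> b"
  shows "evenperm (transpose a b \<circ> w) \<longleftrightarrow> \<not> evenperm w"
  using evenperm_comp[OF permutation_swap_id permutes_imp_permutation[OF assms(1,2)]] assms(3)
  by (simp add: evenperm_swap)

lemma nfact_singleton_id: "nfact {a} id = 1"
proof -
  have "{\<sigma>. ncycle {a} \<sigma> \<and> ncycle {a} (\<sigma> \<circ> id)} = {id}"
    using orbit_eq_singleton_iff[of id a] by (auto simp: ncycle_def cyclic_on_alldef)
  then show ?thesis by (simp add: nfact_def)
qed

text \<open>Cutting a point out of a cycle does not depend on the direction in which the cycle is
  traversed.\<close>

lemma inv_del:
  assumes "u permutes S"
  shows "inv (del y u) = del y (inv u)"
proof -
  have u: "bij u" using assms by (rule permutes_bij)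
  have "inv u \<circ> transpose y (u y) = transpose (inv u y) y \<circ> inv u"
    using inj_comp_transpose[of "inv u" y "u y"] u
    by (simp add: bij_imp_bij_inv bij_is_inj)
  then show ?thesis
    by (simp add: del_def o_inv_distrib[OF bij_transpose u] transpose_commute[of y])
qed

lemma del_conj: "transpose a b \<circ> del a u \<circ> transpose a b = del b (transpose a b \<circ> u \<circ> transpose a b)"
  by (auto simp: del_def fun_eq_iff transpose_def)

text \<open>Both sides delete \<open>x\<close> from \<open>c \<circ> w\<close>, where
  \<open>c\<close> is the 3-cycle sending \<open>y\<close> to \<open>z\<close>, \<open>z\<close> to
  \<open>b\<close> and \<open>b\<close> to \<open>y\<close>. As \<open>c\<close> fixes
  \<open>x\<close>, the deletion of \<open>x\<close> passes through it.\<close>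

lemma del_del_comm:
  assumes "inj w" "w y = b" "x \<noteq> y" "x \<noteq> b" "z \<noteq> x" "z \<noteq> y" "z \<noteq> b" "b \<noteq> y"
  shows "del y (transpose z y \<circ> del x w) = del x (transpose z b \<circ> del y w)"
proof -
  define c where "c = transpose z b \<circ> transpose y b"
  have c: "c = transpose y b \<circ> transpose z y"
    using assms by (auto simp: c_def transpose_def fun_eq_iff)
  have ic: "inj c" unfolding c_def by (intro inj_compose) (auto simp: inj_transpose)
  have cx: "c x = x" using assms by (simp add: c_def)
  have wx: "w x \<noteq> b" using assms by (metis injD)
  have dy: "del x w y = b" using assms wx by (simp add: del_def)
  have "del y (transpose z y \<circ> del x w) = c \<circ> del x w"
    using assms by (simp add: del_def[of y] dy c comp_assoc)
  also have "\<dots> = del x (c \<circ> w)" by (rule del_comp_left[OF ic cx, symmetric])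
  also have "c \<circ> w = transpose z b \<circ> del y w"
    by (simp add: c_def del_def assms(2) comp_assoc)
  finally show ?thesis .
qed

text \<open>The sum counts the full cycles \<open>\<sigma>\<close> for which \<open>\<sigma> \<circ> w\<close> fixes one point and is cyclic on the
  rest. Induction: pick \<open>y\<close> with \<open>b = w y \<noteq> y\<close>, put \<open>w' = del y w\<close>, and expand each summand with
  \<open>x \<noteq> y, b\<close> by \<open>nfact_rec\<close> at \<open>y\<close>. These are the terms with \<open>x \<noteq> b, z\<close> of the same sums for
  the odd permutations \<open>transpose z b \<circ> w'\<close> on \<open>S - {y}\<close>. The remaining terms agree too: on the left
  \<open>x = y\<close> and \<open>x = b\<close> both give \<open>nfact (S - {y}) w'\<close>; on the right \<open>x = b\<close> gives this by
  the recursion at \<open>b\<close>, and \<open>x = z\<close> gives it by the same recursion for the inverse of \<open>w'\<close>.\<close>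
lemma sum_nfact_del:
  assumes "finite S" "w permutes S" "\<not> evenperm w"
  shows "(\<Sum>x\<in>{x\<in>S. w x \<noteq> x}. nfact (S - {x}) (del x w)) = 2 * fact (card S - 2)"
  using assms
proof (induction "card S" arbitrary: S w rule: less_induct)
  case less
  note fin = \<open>finite S\<close> and per = \<open>w permutes S\<close> and odd = \<open>\<not> evenperm w\<close>
  have inj: "inj w" using per by (rule permutes_inj)
  have "w \<noteq> id" using odd evenperm_id by metis
  then obtain y where y: "w y \<noteq> y" by (auto simp: fun_eq_iff)
  then have yS: "y \<in> S" using per by (metis permutes_not_in)
  define b where "b = w y"
  have bS: "b \<in> S" using yS per by (simp add: b_def permutes_in_image)
  have nby: "b \<noteq> y" using y by (simp add: b_def)
  have wb: "w b \<noteq> b" using nby inj unfolding b_def by (metis injD)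
  define S' where "S' = S - {y}"
  define w' where "w' = del y w"
  have fin': "finite S'" and bS': "b \<in> S'" using fin bS nby by (auto simp: S'_def)
  have per': "w' permutes S'" unfolding w'_def S'_def by (rule del_permutes[OF per yS])
  have w'_alt: "w' = transpose y b \<circ> w" by (simp add: w'_def del_def b_def)
  have ev: "evenperm w'" unfolding w'_alt
    using evenperm_transpose_comp[OF fin per nby[symmetric]] odd by simp
  have cS: "card S = Suc (card S')" unfolding S'_def using card_Suc_Diff1[OF fin yS] by simp
  \<comment> \<open>Conjugation by the transposition of \<open>y\<close> and \<open>b\<close> turns
    the removal of \<open>y\<close> into the removal of \<open>b = w y\<close>.\<close>
  have b_eq: "nfact (S - {b}) (del b w) = nfact S' w'"
  proof -
    have "transpose y b \<circ> del y w \<circ> transpose y b = w \<circ> transpose y b"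
      by (simp add: del_def b_def fun_eq_iff)
    also have "\<dots> = del b w"
      using inj_comp_transpose[OF inj, of y b] by (simp add: del_def b_def)
    finally have e: "transpose y b \<circ> w' \<circ> transpose y b = del b w" by (simp add: w'_def)
    have "transpose y b ` S' = S - {b}"
      using yS bS nby by (auto simp: S'_def in_transpose_image_iff transpose_def)
    then show ?thesis using nfact_conj[OF fin', of y b w'] e by simp
  qed
  show ?case
  proof (cases "S' = {b}")
    \<comment> \<open>Base case: \<open>w\<close> swaps two points, each of which contributes 1, and
      \<open>2 = 2 * fact 0\<close>.\<close>
    case True
    have S: "S = {y, b}" using True yS by (auto simp: S'_def)
    have "w' = id" using per' True by simp
    then have "nfact S' w' = 1" using True by (simp add: nfact_singleton_id)
    moreover have "{x\<in>S. w x \<noteq> x} = {y, b}" using S y wb by auto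
    ultimately have "(\<Sum>x\<in>{x\<in>S. w x \<noteq> x}. nfact (S - {x}) (del x w)) = 2"
      using nby b_eq by (simp add: S'_def[symmetric] w'_def[symmetric])
    then show ?thesis using S nby by simp
  next
    case False
    define v where "v z = transpose z b \<circ> w'" for z
    have ne: "S' - {b} \<noteq> {}" using False bS' by blast
    have vper: "v z permutes S'" if "z \<in> S'" for z
      unfolding v_def using that bS' by (intro permutes_compose permutes_swap_id per')
    define M where "M = {x \<in> S - {y, b}. w x \<noteq> x}"
    have IH: "(\<Sum>x\<in>{x\<in>S'. v z x \<noteq> x}. nfact (S' - {x}) (del x (v z))) = 2 * fact (card S' - 2)"
      if "z \<in> S' - {b}" for z
    proof (rule less.hyps)
      show "\<not> evenperm (v z)" unfolding v_def
        using evenperm_transpose_comp[OF fin' per', of z b] ev that by auto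
    qed (use cS fin' vper that in auto)
    \<comment> \<open>Away from \<open>y\<close>, \<open>b\<close> and \<open>z\<close> the
      permutations \<open>v z\<close> and \<open>w\<close> move the same points; \<open>b\<close>
      and \<open>z\<close> are listed separately, each only if \<open>v z\<close> moves it.\<close>
    have split: "(\<Sum>x\<in>{x\<in>S'. v z x \<noteq> x}. nfact (S' - {x}) (del x (v z))) =
        (\<Sum>x\<in>M - {z}. nfact (S' - {x}) (del x (v z))) +
        ((if v z b \<noteq> b then nfact (S' - {b}) (del b (v z)) else 0) +
         (if v z z \<noteq> z then nfact (S' - {z}) (del z (v z)) else 0))"
      if z: "z \<in> S' - {b}" for z
    proof -
      have vx: "v z x \<noteq> x \<longleftrightarrow> w x \<noteq> x" if "x \<notin> {y, b, z}" for x
        using that z by (auto simp: v_def w'_alt S'_def transpose_def)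
      have "{x\<in>S'. v z x \<noteq> x} = (M - {z}) \<union> ({x\<in>{b,z}. v z x \<noteq> x})"
        using vx z bS' by (auto simp: M_def S'_def)
      moreover have "finite M" using fin by (simp add: M_def)
      moreover have "(M - {z}) \<inter> {x\<in>{b,z}. v z x \<noteq> x} = {}" by (auto simp: M_def)
      moreover have "(\<Sum>x\<in>{x\<in>{b,z}. v z x \<noteq> x}. g x) =
          ((if v z b \<noteq> b then g b else 0) + (if v z z \<noteq> z then g z else 0))" for g :: "'a \<Rightarrow> nat"
        using z by (subst sum.inter_filter) auto
      ultimately show ?thesis by (simp add: sum.union_disjoint)
    qed
    \<comment> \<open>This is \<open>nfact_rec\<close> at \<open>b\<close>, with the excluded index
      \<open>z = u b\<close> expressed as a zero summand.\<close>
    have A: "(\<Sum>z\<in>S' - {b}. if u b \<noteq> z then nfact (S' - {b}) (del b (transpose z b \<circ> u)) else 0)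
        = nfact S' u" if "u permutes S'" for u
    proof -
      have "(\<Sum>z\<in>S' - {b}. if u b \<noteq> z then nfact (S' - {b}) (del b (transpose z b \<circ> u)) else 0)
        = (\<Sum>z\<in>{z\<in>S' - {b}. u b \<noteq> z}. nfact (S' - {b}) (del b (transpose z b \<circ> u)))"
        using fin' by (subst sum.inter_filter) auto
      also have "{z\<in>S' - {b}. u b \<noteq> z} = S' - {b, u b}" by auto
      finally show ?thesis
        using nfact_rec[OF fin' bS' ne that] by (simp add: o_def)
    qed
    have A1: "(\<Sum>z\<in>S' - {b}. if v z b \<noteq> b then nfact (S' - {b}) (del b (v z)) else 0) = nfact S' w'"
    proof -
      have "v z b \<noteq> b \<longleftrightarrow> w' b \<noteq> z" for z by (auto simp: v_def transpose_def)
      then show ?thesis using A[OF per', folded v_def] by simp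
    qed
    \<comment> \<open>Relabelling \<open>z\<close> as \<open>b\<close> turns the summand into a
      deletion of \<open>b\<close> from \<open>w' \<circ> transpose z b\<close>; inverting gives a
      summand of the recursion for \<open>inv w'\<close>.\<close>
    have A2: "(\<Sum>z\<in>S' - {b}. if v z z \<noteq> z then nfact (S' - {z}) (del z (v z)) else 0) = nfact S' w'"
    proof -
      have "(if v z z \<noteq> z then nfact (S' - {z}) (del z (v z)) else 0) =
          (if inv w' b \<noteq> z then nfact (S' - {b}) (del b (transpose z b \<circ> inv w')) else 0)"
        if z: "z \<in> S' - {b}" for z
      proof -
        let ?t = "transpose z b"
        have p1: "w' \<circ> ?t permutes S'"
          using z bS' by (intro permutes_compose permutes_swap_id per') auto
        have "v z z \<noteq> z \<longleftrightarrow> w' z \<noteq> b" by (auto simp: v_def transpose_def)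
        also have "\<dots> \<longleftrightarrow> inv w' b \<noteq> z" using per' by (auto simp: permutes_inv_eq)
        finally have iff: "v z z \<noteq> z \<longleftrightarrow> inv w' b \<noteq> z" .
        have "?t ` (S' - {z}) = S' - {b}"
          using z bS' by (auto simp: in_transpose_image_iff transpose_def)
        moreover have "?t \<circ> del z (v z) \<circ> ?t = del b (w' \<circ> ?t)"
        proof -
          have "?t \<circ> v z \<circ> ?t = w' \<circ> ?t" by (simp add: v_def fun_eq_iff)
          then show ?thesis using del_conj[of z b "v z"] by simp
        qed
        ultimately have "nfact (S' - {z}) (del z (v z)) = nfact (S' - {b}) (del b (w' \<circ> ?t))"
          using nfact_conj[of "S' - {z}" z b "del z (v z)"] fin' by simp
        also have "\<dots> = nfact (S' - {b}) (inv (del b (w' \<circ> ?t)))"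
          by (rule nfact_inv[symmetric, OF del_permutes[OF p1 bS']])
        also have "inv (del b (w' \<circ> ?t)) = del b (transpose z b \<circ> inv w')"
          by (simp add: inv_del[OF p1] o_inv_distrib[OF permutes_bij[OF per']])
        finally show ?thesis using iff by simp
      qed
      from trans[OF sum.cong[OF refl this] A[OF permutes_inv[OF per']]] show ?thesis by (simp add: nfact_inv[OF per'])
    qed
    \<comment> \<open>After the removal of \<open>x\<close>, the point \<open>y\<close> is still
      sent to \<open>b\<close>. Recursion at \<open>y\<close> and \<open>del_del_comm\<close> then
      exchange the two deletions.\<close>
    have main: "nfact (S - {x}) (del x w) = (\<Sum>z\<in>S' - {b, x}. nfact (S' - {x}) (del x (v z)))"
      if x: "x \<in> M" for x
    proof -
      have x': "x \<in> S" "x \<noteq> y" "x \<noteq> b" "w x \<noteq> x" using x by (auto simp: M_def)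
      have wx: "w x \<noteq> b" using x' inj unfolding b_def by (metis injD)
      have dy: "del x w y = b" using x' wx by (simp add: del_def b_def)
      have "nfact (S - {x}) (del x w) =
          (\<Sum>z\<in>S - {x} - {y, del x w y}. nfact (S - {x} - {y}) (del y (transpose z y \<circ> del x w)))"
        using x' fin yS bS nby by (intro nfact_rec del_permutes per) auto
      also have "\<dots> = (\<Sum>z\<in>S' - {b, x}. nfact (S' - {x}) (del x (v z)))"
      proof (rule sum.cong)
        show "S - {x} - {y, del x w y} = S' - {b, x}" by (auto simp: S'_def dy)
        fix z assume z: "z \<in> S' - {b, x}"
        have "del y (transpose z y \<circ> del x w) = del x (v z)"
          unfolding v_def w'_def using z x' nby
          by (intro del_del_comm inj) (auto simp: b_def S'_def)
        moreover have "S - {x} - {y} = S' - {x}" by (auto simp: S'_def)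
        ultimately show "nfact (S - {x} - {y}) (del y (transpose z y \<circ> del x w)) = nfact (S' - {x}) (del x (v z))"
          by simp
      qed
      finally show ?thesis .
    qed
    have fM: "finite M" using fin by (simp add: M_def)
    have "(\<Sum>x\<in>{x\<in>S. w x \<noteq> x}. nfact (S - {x}) (del x w)) =
        (\<Sum>x\<in>M. nfact (S - {x}) (del x w)) + (nfact S' w' + nfact S' w')"
    proof -
      have "{x\<in>S. w x \<noteq> x} = insert y (insert b M)" "y \<notin> insert b M" "b \<notin> M"
        using yS bS y wb nby by (auto simp: M_def)
      then show ?thesis using fM b_eq by (simp add: S'_def[symmetric] w'_def[symmetric])
    qed
    also have "(\<Sum>x\<in>M. nfact (S - {x}) (del x w)) =
        (\<Sum>x\<in>M. \<Sum>z\<in>S' - {b, x}. nfact (S' - {x}) (del x (v z)))"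
      by (rule sum.cong[OF refl main])
    also have "\<dots> = (\<Sum>x\<in>M. \<Sum>z\<in>{z\<in>S' - {b}. z \<noteq> x}. nfact (S' - {x}) (del x (v z)))"
      by (intro sum.cong refl) auto
    also have "\<dots> = (\<Sum>z\<in>S' - {b}. \<Sum>x\<in>{x\<in>M. z \<noteq> x}. nfact (S' - {x}) (del x (v z)))"
      by (rule sum.swap_restrict) (use fM fin' in auto)
    also have "\<dots> = (\<Sum>z\<in>S' - {b}. \<Sum>x\<in>M - {z}. nfact (S' - {x}) (del x (v z)))"
      by (intro sum.cong refl) auto
    \<comment> \<open>By \<open>A1\<close> and \<open>A2\<close> the two copies of
      \<open>nfact S' w'\<close> supply exactly the summands for \<open>b\<close> and
      \<open>z\<close> that were missing.\<close>
    also have "\<dots> + (nfact S' w' + nfact S' w') =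
        (\<Sum>z\<in>S' - {b}. \<Sum>x\<in>{x\<in>S'. v z x \<noteq> x}. nfact (S' - {x}) (del x (v z)))"
      by (simp only: split sum.distrib A1 A2 cong: sum.cong)
    also have "\<dots> = (\<Sum>z\<in>S' - {b}. 2 * fact (card S' - 2))"
      by (rule sum.cong[OF refl IH])
    also have "\<dots> = 2 * (card (S' - {b}) * fact (card S' - 2))" by simp
    \<comment> \<open>Here \<open>S'\<close> has at least two points, so the truncated subtraction
      is exact.\<close>
    also have "card (S' - {b}) = Suc (card S' - 2)"
    proof -
      have "card (S' - {b}) > 0" using ne fin' by (simp add: card_gt_0_iff)
      then show ?thesis using bS' fin' by simp
    qed
    also have "Suc (card S' - 2) * fact (card S' - 2) = (fact (card S - 2) :: nat)"
    proof -
      have "card (S' - {b}) > 0" using ne fin' by (simp add: card_gt_0_iff)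
      then have "card S - 2 = Suc (card S' - 2)" using bS' fin' cS by simp
      then show ?thesis by simp
    qed
    finally show ?thesis .
  qed
qed

subsection \<open>Colour-preserving permutations\<close>

text \<open>The Young subgroup belonging to the colour classes of \<open>f\<close> on
  \<open>S\<close>.\<close>

definition stab :: "'a set \<Rightarrow> ('a \<Rightarrow> 'b) \<Rightarrow> ('a \<Rightarrow> 'a) set" where
  "stab S f = {w. w permutes S \<and> (\<forall>x\<in>S. f (w x) = f x)}"

definition sepcount :: "'a set \<Rightarrow> ('a \<Rightarrow> 'b) \<Rightarrow> nat" where
  "sepcount S f = (\<Sum>w\<in>stab S f. nfact S w)"

lemma finite_stab: "finite S \<Longrightarrow> finite (stab S f)"
  by (rule finite_subset[OF _ finite_permutations[of S]]) (auto simp: stab_def)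

lemma stab_cong: "(\<And>x. x \<in> S \<Longrightarrow> f x = g x) \<Longrightarrow> stab S f = stab S g"
  by (auto simp: stab_def permutes_in_image)

text \<open>A permutation is recovered from the image of \<open>x\<close> and the result of cutting
  \<open>x\<close> out, by composing with the transposition of these two points. Colours are
  preserved because both points have the same one.\<close>

lemma bij_betw_stab:
  assumes "x \<in> S"
  shows "bij_betw (\<lambda>w. (w x, del x w)) (stab S f) ({b\<in>S. f b = f x} \<times> stab (S - {x}) f)"
proof (rule bij_betwI[where g = "\<lambda>(b, u). transpose x b \<circ> u"])
  show "(\<lambda>w. (w x, del x w)) \<in> stab S f \<rightarrow> {b\<in>S. f b = f x} \<times> stab (S - {x}) f"
  proof
    fix w assume "w \<in> stab S f"
    then have w: "w permutes S" "\<And>z. z \<in> S \<Longrightarrow> f (w z) = f z" by (auto simp: stab_def)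
    have "f (del x w z) = f z" if "z \<in> S - {x}" for z
      using that w(2)[of z] w(2)[OF assms] del_other[OF permutes_inj[OF w(1)], of z x] by auto
    then show "(w x, del x w) \<in> {b\<in>S. f b = f x} \<times> stab (S - {x}) f"
      using w assms del_permutes[OF w(1) assms] by (auto simp: stab_def permutes_in_image)
  qed
  have ux: "u x = x" if "u \<in> stab (S - {x}) f" for u
    using that by (auto simp: stab_def permutes_not_in)
  show "(\<lambda>(b, u). transpose x b \<circ> u) \<in> {b\<in>S. f b = f x} \<times> stab (S - {x}) f \<rightarrow> stab S f"
  proof
    fix p assume "p \<in> {b\<in>S. f b = f x} \<times> stab (S - {x}) f"
    then obtain b u where p: "p = (b, u)" "b \<in> S" "f b = f x" "u \<in> stab (S - {x}) f" by blast
    have u: "u permutes (S - {x})" "\<And>z. z \<in> S - {x} \<Longrightarrow> f (u z) = f z"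
      using p(4) by (auto simp: stab_def)
    have "u permutes S" by (rule permutes_subset[OF u(1)]) auto
    then have "transpose x b \<circ> u permutes S"
      using p assms by (intro permutes_compose permutes_swap_id)
    moreover have "f (u z) = f z" if "z \<in> S" for z
      using u(2)[of z] ux[OF p(4)] that by (cases "z = x") auto
    moreover have "f (transpose x b z) = f z" for z
      using p(3) by (auto simp: transpose_def)
    ultimately show "(case p of (b, u) \<Rightarrow> transpose x b \<circ> u) \<in> stab S f"
      using p(1) by (auto simp: stab_def)
  qed
  show "(case (w x, del x w) of (b, u) \<Rightarrow> transpose x b \<circ> u) = w" for w
    by (simp add: del_def fun_eq_iff)
  show "(\<lambda>w. (w x, del x w)) (case p of (b, u) \<Rightarrow> transpose x b \<circ> u) = p"
    if "p \<in> {b\<in>S. f b = f x} \<times> stab (S - {x}) f" for p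
  proof -
    obtain b u where p: "p = (b, u)" "u \<in> stab (S - {x}) f" using \<open>p \<in> _\<close> by blast
    then show ?thesis using ux[OF p(2)] by (simp add: del_def fun_eq_iff)
  qed
qed

lemma card_stab_rec:
  assumes "x \<in> S"
  shows "card (stab S f) = card {b\<in>S. f b = f x} * card (stab (S - {x}) f)"
  using bij_betw_same_card[OF bij_betw_stab[OF assms]] by (simp add: card_cartesian_product)

text \<open>Each \<open>u\<close> arises once for every choice of \<open>w x\<close> among the other
  points of the colour of \<open>x\<close>.\<close>

lemma sum_stab_del:
  fixes g :: "('a \<Rightarrow> 'a) \<Rightarrow> nat"
  assumes "finite S" "x \<in> S"
  shows "(\<Sum>w\<in>stab S f. if w x \<noteq> x then g (del x w) else 0) =
    card {b\<in>S - {x}. f b = f x} * (\<Sum>u\<in>stab (S - {x}) f. g u)"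
proof -
  have "(\<Sum>w\<in>stab S f. if w x \<noteq> x then g (del x w) else 0) =
      (\<Sum>(b, u)\<in>{b\<in>S. f b = f x} \<times> stab (S - {x}) f. if b \<noteq> x then g u else 0)"
    by (subst sum.reindex_bij_betw[OF bij_betw_stab[OF assms(2)], symmetric]) simp
  also have "\<dots> = (\<Sum>b\<in>{b\<in>S. f b = f x}. if b \<noteq> x then (\<Sum>u\<in>stab (S - {x}) f. g u) else 0)"
    by (subst sum.cartesian_product[symmetric]) (intro sum.cong, auto)
  also have "\<dots> = (\<Sum>b\<in>{b\<in>S - {x}. f b = f x}. \<Sum>u\<in>stab (S - {x}) f. g u)"
    using assms(1) by (intro sum.mono_neutral_cong_right) auto
  finally show ?thesis by simp
qed

section \<open>Parity and the deletion identity for a colouring\<close>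

lemma ncycle_evenperm_eq:
  assumes "finite S" "ncycle S \<sigma>" "ncycle S \<tau>"
  shows "evenperm \<sigma> \<longleftrightarrow> evenperm \<tau>"
  using assms
proof (induction "card S" arbitrary: S \<sigma> \<tau> rule: less_induct)
  case less
  note \<sigma> = ncycle_permutes[OF less.prems(2)] and \<tau> = ncycle_permutes[OF less.prems(3)]
  show ?case
  proof (cases "\<exists>y\<in>S. S - {y} \<noteq> {}")
    case True
    then obtain y where y: "y \<in> S" "S - {y} \<noteq> {}" by blast
    \<comment> \<open>Deleting a point keeps a full cycle full and flips its parity, so the
      comparison descends to smaller sets.\<close>
    have e: "ncycle (S - {y}) (del y \<rho>)" "evenperm (del y \<rho>) \<longleftrightarrow> \<not> evenperm \<rho>"
      if "ncycle S \<rho>" for \<rho>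
    proof -
      note \<rho> = ncycle_permutes[OF that]
      have nf: "\<rho> y \<noteq> y" by (rule ncycle_no_fixpoint[OF that y])
      show "ncycle (S - {y}) (del y \<rho>)"
        using ncycle_del_iff[OF less.prems(1) y(1) \<rho> nf] that by simp
      show "evenperm (del y \<rho>) \<longleftrightarrow> \<not> evenperm \<rho>"
        unfolding del_def by (rule evenperm_transpose_comp[OF less.prems(1) \<rho> nf[symmetric]])
    qed
    have "card (S - {y}) < card S" using y less.prems(1) by (rule_tac card_Diff1_less) auto
    from less.hyps[OF this _ e(1)[OF less.prems(2)] e(1)[OF less.prems(3)]]
    show ?thesis using e(2)[OF less.prems(2)] e(2)[OF less.prems(3)] less.prems(1) by simp
  next
    case False
    then have "S = {} \<or> (\<exists>y. S = {y})" by blast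
    then have "\<sigma> = id" "\<tau> = id" using \<sigma> \<tau> by auto
    then show ?thesis by simp
  qed
qed

lemma nfact_odd:
  assumes "finite S" "w permutes S" "\<not> evenperm w"
  shows "nfact S w = 0"
proof -
  have False if "ncycle S \<sigma>" "ncycle S (\<sigma> \<circ> w)" for \<sigma>
    using ncycle_evenperm_eq[OF assms(1) that] assms ncycle_permutes[OF that(1)]
      evenperm_comp[of \<sigma> w] by (metis permutes_imp_permutation)
  then have "{\<sigma>. ncycle S \<sigma> \<and> ncycle S (\<sigma> \<circ> w)} = {}" by blast
  then show ?thesis unfolding nfact_def by (simp only: card.empty)
qed

text \<open>Composition with the transposition of two equally coloured points pairs the odd elements
  with the even ones.\<close>

lemma card_odd_stab:
  assumes "finite S" "a \<in> S" "b \<in> S" "a \<noteq> b" "f a = f b"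
  shows "2 * card {w\<in>stab S f. \<not> evenperm w} = card (stab S f)"
proof -
  let ?O = "{w\<in>stab S f. \<not> evenperm w}" and ?E = "{w\<in>stab S f. evenperm w}"
  have st: "transpose a b \<circ> w \<in> stab S f" if "w \<in> stab S f" for w
  proof -
    have "f (transpose a b z) = f z" for z using assms(5) by (auto simp: transpose_def)
    then show ?thesis using that assms
      by (auto simp: stab_def intro!: permutes_compose permutes_swap_id)
  qed
  have ev: "evenperm (transpose a b \<circ> w) \<longleftrightarrow> \<not> evenperm w" if "w \<in> stab S f" for w
    using that assms by (intro evenperm_transpose_comp[of S]) (auto simp: stab_def)
  have "bij_betw (\<lambda>w. transpose a b \<circ> w) ?O ?E"
    by (rule bij_betwI[where g = "\<lambda>w. transpose a b \<circ> w"]) (auto simp: st ev fun_eq_iff)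
  then have "card ?O = card ?E" by (rule bij_betw_same_card)
  moreover have "card (stab S f) = card ?O + card ?E"
    using finite_stab[OF assms(1), of f]
    by (subst card_Un_disjoint[symmetric]) (auto intro: arg_cong[of _ _ card])
  ultimately show ?thesis by simp
qed

text \<open>Double counting of pairs of a point and a colour-preserving \<open>w\<close> that moves
  it. An even \<open>w\<close> contributes nothing, since a deletion makes it odd; an odd
  \<open>w\<close> contributes the constant of \<open>sum_nfact_del\<close>, and half of the group
  is odd.\<close>

lemma sum_sepcount_del:
  assumes "finite S" "a \<in> S" "b \<in> S" "a \<noteq> b" "f a = f b"
  shows "(\<Sum>x\<in>S. card {b\<in>S - {x}. f b = f x} * sepcount (S - {x}) f) =
    fact (card S - 2) * card (stab S f)"
proof -
  let ?g = "\<lambda>x w. if w x \<noteq> x then nfact (S - {x}) (del x w) else 0"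
  have "(\<Sum>x\<in>S. card {b\<in>S - {x}. f b = f x} * sepcount (S - {x}) f) =
      (\<Sum>x\<in>S. \<Sum>w\<in>stab S f. ?g x w)"
    unfolding sepcount_def by (rule sum.cong[OF refl]) (rule sum_stab_del[OF assms(1), symmetric])
  also have "\<dots> = (\<Sum>w\<in>stab S f. \<Sum>x\<in>S. ?g x w)" by (rule sum.swap)
  also have "\<dots> = (\<Sum>w\<in>stab S f. if \<not> evenperm w then 2 * fact (card S - 2) else 0)"
  proof (rule sum.cong[OF refl])
    fix w assume "w \<in> stab S f"
    then have w: "w permutes S" by (simp add: stab_def)
    show "(\<Sum>x\<in>S. ?g x w) = (if \<not> evenperm w then 2 * fact (card S - 2) else 0)"
    proof (cases "evenperm w")
      case True
      have "?g x w = 0" if x: "x \<in> S" for x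
      proof (cases "w x = x")
        case False
        then have "\<not> evenperm (del x w)"
          unfolding del_def using evenperm_transpose_comp[OF assms(1) w] True by metis
        then show ?thesis using nfact_odd[OF _ del_permutes[OF w x]] assms(1) by simp
      qed simp
      then show ?thesis using True by simp
    next
      case False
      have "(\<Sum>x\<in>S. ?g x w) = (\<Sum>x\<in>{x\<in>S. w x \<noteq> x}. nfact (S - {x}) (del x w))"
        using assms(1) by (simp add: sum.inter_filter)
      then show ?thesis using sum_nfact_del[OF assms(1) w False] False by simp
    qed
  qed
  also have "\<dots> = (\<Sum>w\<in>{w\<in>stab S f. \<not> evenperm w}. 2 * fact (card S - 2))"
    using finite_stab[OF assms(1)] by (subst sum.inter_filter) auto
  also have "\<dots> = fact (card S - 2) * (2 * card {w\<in>stab S f. \<not> evenperm w})" by simp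
  finally show ?thesis by (simp only: card_odd_stab[OF assms])
qed

text \<open>When only one of \<open>a\<close> and \<open>b\<close> lies in \<open>S\<close>, this
  replaces it by the other point of its colour.\<close>

lemma sepcount_transpose:
  assumes "finite S" "f a = f b"
  shows "sepcount (transpose a b ` S) f = sepcount S f"
proof -
  let ?c = "\<lambda>w. transpose a b \<circ> w \<circ> transpose a b"
  have ft: "f (transpose a b z) = f z" for z using assms(2) by (auto simp: transpose_def)
  have c: "?c w \<in> stab (transpose a b ` S) f" if "w \<in> stab S f" for w S
  proof -
    have w: "w permutes S" "\<And>z. z \<in> S \<Longrightarrow> f (w z) = f z" using that by (auto simp: stab_def)
    have "bij_betw w S S" using w(1) by (rule permutes_imp_bij)
    moreover have "bij_betw (transpose a b) S (transpose a b ` S)"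
        "bij_betw (transpose a b) (transpose a b ` S) S"
      by (auto simp: bij_betw_def image_image)
    ultimately have "bij_betw (?c w) (transpose a b ` S) (transpose a b ` S)"
      by (meson bij_betw_trans)
    then have "?c w permutes (transpose a b ` S)"
    proof (rule bij_imp_permutes)
      fix x assume "x \<notin> transpose a b ` S"
      then have "transpose a b x \<notin> S" by (metis image_eqI transpose_involutory)
      then show "?c w x = x" using w(1) by (simp add: permutes_not_in)
    qed
    then show ?thesis using w(2) by (auto simp: stab_def ft)
  qed
  have "bij_betw ?c (stab S f) (stab (transpose a b ` S) f)"
  proof (rule bij_betwI[where g = ?c])
    show "?c \<in> stab (transpose a b ` S) f \<rightarrow> stab S f"
      using c[of _ "transpose a b ` S"] by (auto simp: image_image)
  qed (use c in \<open>auto simp: fun_eq_iff\<close>)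
  then have "sepcount (transpose a b ` S) f = (\<Sum>w\<in>stab S f. nfact (transpose a b ` S) (?c w))"
    unfolding sepcount_def by (rule sum.reindex_bij_betw[symmetric])
  then show ?thesis by (simp only: nfact_conj[OF assms(1)] sepcount_def)
qed

section \<open>Evaluation of the count for a colouring\<close>

lemma sum_inverse_fibre:
  assumes "finite S"
  shows "(\<Sum>x\<in>S. 1 / real (card {z\<in>S. f z = f x})) = card (f ` S)"
proof -
  have "(\<Sum>x\<in>S. 1 / real (card {z\<in>S. f z = f x})) =
      (\<Sum>c\<in>f ` S. \<Sum>x\<in>{x\<in>S. f x = c}. 1 / real (card {z\<in>S. f z = f x}))"
    by (rule sum.image_gen[OF assms])
  also have "\<dots> = (\<Sum>c\<in>f ` S. 1)"
  proof (rule sum.cong[OF refl])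
    fix c assume "c \<in> f ` S"
    then have "card {z\<in>S. f z = c} > 0" using assms by (auto simp: card_gt_0_iff)
    then show "(\<Sum>x\<in>{x\<in>S. f x = c}. 1 / real (card {z\<in>S. f z = f x})) = 1" by simp
  qed
  finally show ?thesis by simp
qed

text \<open>Adding a point \<open>y\<close> of the fixed colour \<open>c\<close> and applying \<open>sum_sepcount_del\<close> expresses
  \<open>sepcount S f\<close> through the sets \<open>insert y S - {x}\<close> with \<open>f x \<noteq> c\<close>, which have fewer points of
  other colours.\<close>
lemma sepcount_formula:
  fixes S :: "'a set" and f :: "'a \<Rightarrow> 'b"
  assumes "infinite (UNIV :: 'a set)" "finite S" "a \<in> S" "f a = c"
  shows "real (sepcount S f) * (real (card S) + 1 - real (card (f ` S))) =
    fact (card S - 1) * real (card (stab S f))"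
  using assms(2-4)
proof (induction "card {x\<in>S. f x \<noteq> c}" arbitrary: S f rule: less_induct)
  case less
  note fin = \<open>finite S\<close> and a = \<open>a \<in> S\<close> \<open>f a = c\<close>
  obtain y where y: "y \<notin> S" using ex_new_if_finite[OF assms(1) fin] by blast
  define f' where "f' = f(y := c)"
  define S' where "S' = insert y S"
  define A where "A = {x\<in>S'. f' x = c}"
  define B where "B = {x\<in>S. f x \<noteq> c}"
  define \<beta> where "\<beta> x = card {z\<in>S'. f' z = f' x}" for x
  define Y where "Y = real (card (stab S' f'))"
  define n where "n = card S"
  define k where "k = card (f ` S)"
  define \<alpha> where "\<alpha> = card {x\<in>S. f x = c}"
  define G where "G x = real (card {z\<in>S' - {x}. f' z = f' x} * sepcount (S' - {x}) f')" for x
  define D where "D = real n + 1 - real k"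
  have f'[simp]: "f' y = c" "\<And>x. x \<in> S \<Longrightarrow> f' x = f x" using y by (auto simp: f'_def)
  have fin': "finite S'" and aS': "a \<in> S'" and cS': "card S' = n + 1"
    using fin a y by (auto simp: S'_def n_def)
  have finAB: "finite A" "finite B" "S' = A \<union> B" "A \<inter> B = {}"
    using fin y by (auto simp: A_def B_def S'_def)
  have "A = insert y {x\<in>S. f x = c}" by (auto simp: A_def S'_def)
  then have cA: "card A = \<alpha> + 1" using y fin by (simp add: \<alpha>_def)
  have \<alpha>_pos: "\<alpha> > 0" using a fin by (auto simp: \<alpha>_def card_gt_0_iff)
  have cB: "real (card B) = real n - real \<alpha>"
  proof -
    have "n = \<alpha> + card B" unfolding n_def \<alpha>_def B_def
      using fin by (subst card_Un_disjoint[symmetric]) (auto intro: arg_cong[of _ _ card])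
    then show ?thesis by simp
  qed
  have k1: "card (f ` B) + 1 = k"
  proof -
    have "f ` S = insert c (f ` B)" "c \<notin> f ` B" using a by (auto simp: B_def)
    then show ?thesis using finAB by (simp add: k_def)
  qed
  have \<beta>_pos: "\<beta> x > 0" if "x \<in> S'" for x
    using that fin' by (auto simp: \<beta>_def card_gt_0_iff)
  have \<beta>_del: "card {z\<in>S' - {x}. f' z = f' x} = \<beta> x - 1" if "x \<in> S'" for x
  proof -
    have "{z\<in>S' - {x}. f' z = f' x} = {z\<in>S'. f' z = f' x} - {x}" by auto
    then show ?thesis using that fin' by (simp add: \<beta>_def)
  qed
  \<comment> \<open>Removing a point of colour \<open>c\<close> from \<open>S'\<close> leaves
    \<open>S\<close> up to an exchange with \<open>y\<close>. The class of \<open>c\<close> in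
    \<open>S'\<close> has \<open>\<alpha> + 1\<close> points, which gives the factor
    \<open>\<alpha>\<close>.\<close>
  have A_term: "G x = \<alpha> * real (sepcount S f)"
    if x: "x \<in> A" for x
  proof -
    have "transpose y x ` S = S' - {x}"
      using x y by (auto simp: A_def S'_def in_transpose_image_iff transpose_def)
    then have "sepcount (S' - {x}) f' = sepcount S f'"
      using sepcount_transpose[OF fin, of f' y x] x by (simp add: A_def)
    also have "\<dots> = sepcount S f" unfolding sepcount_def using stab_cong[of S f' f] by simp
    finally have "sepcount (S' - {x}) f' = sepcount S f" .
    moreover have "\<beta> x = card A" using x by (simp add: \<beta>_def A_def)
    ultimately show ?thesis using \<beta>_del[of x] x cA by (simp add: A_def G_def)
  qed
  have B_term: "G x * D =
      fact (n - 1) * Y * (1 - 1 / real (card {z\<in>B. f z = f x}))" if x: "x \<in> B" for x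
  proof -
    have xS: "x \<in> S" "x \<in> S'" "f x \<noteq> c" using x by (auto simp: B_def S'_def)
    have "{z\<in>S'. f' z = f' x} = {z\<in>B. f z = f x}" using xS by (auto simp: B_def S'_def)
    then have \<beta>B: "\<beta> x = card {z\<in>B. f z = f x}" by (simp add: \<beta>_def)
    have Y: "Y = \<beta> x * real (card (stab (S' - {x}) f'))"
      unfolding Y_def \<beta>_def using card_stab_rec[OF xS(2), of f'] by simp
    show ?thesis
    \<comment> \<open>If \<open>x\<close> is alone in its class, its removal would lose a colour,
      but both sides vanish. Otherwise the number of colours stays \<open>k\<close>, so the
      induction hypothesis has the same factor \<open>D\<close>.\<close>
    proof (cases "\<beta> x = 1")
      case True
      then show ?thesis using \<beta>_del[OF xS(2)] \<beta>B by (simp add: G_def)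
    next
      case False
      then have b2: "\<beta> x > 1" using \<beta>_pos[OF xS(2)] by simp
      have "{z\<in>S' - {x}. f' z \<noteq> c} = B - {x}" by (auto simp: B_def S'_def)
      then have m: "card {z\<in>S' - {x}. f' z \<noteq> c} < card {z\<in>S. f z \<noteq> c}"
        using card_Diff1_less[OF finAB(2) x] by (simp add: B_def)
      have im: "f' ` (S' - {x}) = f ` S"
      proof -
        obtain z where "z \<in> S' - {x}" "f' z = f' x"
          using b2 \<beta>_del[OF xS(2)] by (metis (mono_tags, lifting) card.empty empty_Collect_eq less_numeral_extra(3) mem_Collect_eq zero_less_diff)
        then have z: "z \<in> S - {x}" "f z = f x" using xS by (auto simp: S'_def)
        have "f ` S = f ` (S - {x})" using z xS by (metis (no_types, lifting) image_insert insert_Diff insert_absorb image_eqI)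
        moreover have "f' ` (S' - {x}) = insert c (f ` (S - {x}))"
        proof -
          have "S' - {x} = insert y (S - {x})" using y xS by (auto simp: S'_def)
          moreover have "f' ` (S - {x}) = f ` (S - {x})" by (rule image_cong) auto
          ultimately show ?thesis by simp
        qed
        moreover have "c \<in> f ` (S - {x})" using a xS by (metis Diff_iff image_eqI singletonD)
        ultimately show ?thesis by auto
      qed
      have "real (sepcount (S' - {x}) f') * D = fact (n - 1) * real (card (stab (S' - {x}) f'))"
        using less.hyps[OF m] fin' aS' a xS cS' im by (auto simp: D_def n_def k_def)
      moreover have "real (\<beta> x - 1) = real (\<beta> x) * (1 - 1 / real (\<beta> x))"
        using b2 by (simp add: right_diff_distrib)
      ultimately show ?thesis unfolding G_def \<beta>_del[OF xS(2)] Y \<beta>B[symmetric] of_nat_mult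
        by (simp only: mult.assoc) (simp only: mult_ac)
    qed
  qed
  have "(\<Sum>x\<in>S'. G x) =
      fact (n - 1) * Y"
  proof -
    have "f' a = f' y" "a \<noteq> y" "y \<in> S'" using a y by (auto simp: S'_def)
    from sum_sepcount_del[OF fin' aS' this(3,2,1)]
    have "real (\<Sum>x\<in>S'. card {z\<in>S' - {x}. f' z = f' x} * sepcount (S' - {x}) f') =
        real (fact (n - 1) * card (stab S' f'))"
      using cS' by simp
    then show ?thesis by (simp add: Y_def G_def)
  qed
  moreover have "(\<Sum>x\<in>S'. G x) = (\<Sum>x\<in>A. G x) + (\<Sum>x\<in>B. G x)"
    unfolding finAB(3) by (rule sum.union_disjoint[OF finAB(1,2,4)])
  ultimately have "fact (n - 1) * Y * D =
      (\<Sum>x\<in>A. G x) * D +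
      (\<Sum>x\<in>B. G x * D)"
    by (simp flip: sum_distrib_right distrib_right)
  also have "(\<Sum>x\<in>A. G x) =
      (\<alpha> + 1) * (\<alpha> * real (sepcount S f))"
    using A_term cA by simp
  also have "(\<Sum>x\<in>B. G x * D) =
      (\<Sum>x\<in>B. fact (n - 1) * Y * (1 - 1 / real (card {z\<in>B. f z = f x})))"
    by (rule sum.cong[OF refl B_term])
  also have "\<dots> = fact (n - 1) * Y * (real (card B) - real (card (f ` B)))"
    using sum_inverse_fibre[OF finAB(2), of f]
    by (simp only: sum_distrib_left[symmetric] sum_subtractf) simp
  \<comment> \<open>\<open>B\<close> has \<open>n - \<alpha>\<close> points in \<open>k - 1\<close>
    colours. The terms with \<open>D\<close> then cancel against the left side and leave a multiple
    of \<open>\<alpha>\<close>.\<close>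
  also have "real (card B) - real (card (f ` B)) = D - \<alpha>"
    using cB k1 by (simp add: D_def)
  finally have "(\<alpha> + 1) * \<alpha> * (real (sepcount S f) * D) = \<alpha> * (fact (n - 1) * Y)"
    by (simp add: algebra_simps)
  moreover have "Y = (\<alpha> + 1) * real (card (stab S f))"
  proof -
    have "{b\<in>S'. f' b = f' y} = A" "S' - {y} = S" using y by (auto simp: A_def S'_def)
    then have "Y = (\<alpha> + 1) * real (card (stab S f'))"
      using card_stab_rec[of y S' f'] cA by (simp add: Y_def S'_def distrib_right)
    then show ?thesis using stab_cong[of S f' f] by simp
  qed
  ultimately have "(real \<alpha> + 1) * real \<alpha> * (real (sepcount S f) * D) =
      (real \<alpha> + 1) * real \<alpha> * (fact (n - 1) * real (card (stab S f)))"
    by (simp add: algebra_simps)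
  then have "real (sepcount S f) * D = fact (n - 1) * real (card (stab S f))"
    using \<alpha>_pos by (simp add: add_eq_0_iff)
  then show ?case by (simp add: D_def n_def k_def)
qed

text \<open>Colours in \<open>C\<close> that do not occur contribute \<open>fact 0 = 1\<close>; thus
  \<open>C\<close> stays fixed while \<open>S\<close> grows in the induction.\<close>

lemma card_stab:
  assumes "finite S" "finite C" "f ` S \<subseteq> C"
  shows "card (stab S f) = (\<Prod>c\<in>C. fact (card {x\<in>S. f x = c}))"
  using assms(1,3)
proof (induction S)
  case empty
  have "stab {} f = {id}" by (auto simp: stab_def)
  then show ?case by simp
next
  case (insert x S)
  have x: "f x \<in> C" using insert.prems by auto
  have e1: "{b\<in>insert x S. f b = f x} = insert x {b\<in>S. f b = f x}" by auto
  have e2: "{b\<in>insert x S. f b = c} = {b\<in>S. f b = c}" if "c \<noteq> f x" for c using that by auto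
  have "card (stab (insert x S) f) = Suc (card {b\<in>S. f b = f x}) * card (stab S f)"
    using card_stab_rec[of x "insert x S" f] insert.hyps e1 by simp
  also have "card (stab S f) = (\<Prod>c\<in>C. fact (card {x\<in>S. f x = c}))"
    using insert by simp
  also have "\<dots> = fact (card {b\<in>S. f b = f x}) * (\<Prod>c\<in>C - {f x}. fact (card {x\<in>S. f x = c}))"
    by (rule prod.remove[OF assms(2) x])
  also have "Suc (card {b\<in>S. f b = f x}) * \<dots> =
      fact (card {b\<in>insert x S. f b = f x}) * (\<Prod>c\<in>C - {f x}. fact (card {b\<in>insert x S. f b = c}))"
  proof -
    have "fact (card {b\<in>insert x S. f b = f x}) =
        Suc (card {b\<in>S. f b = f x}) * (fact (card {b\<in>S. f b = f x}) :: nat)"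
      unfolding e1 using insert.hyps by simp
    moreover have "(\<Prod>c\<in>C - {f x}. fact (card {b\<in>insert x S. f b = c})) =
        (\<Prod>c\<in>C - {f x}. fact (card {x\<in>S. f x = c}) :: nat)"
      by (rule prod.cong[OF refl]) (metis DiffD2 e2 insertI1)
    ultimately show ?thesis by (simp only: mult.assoc)
  qed
  also have "\<dots> = (\<Prod>c\<in>C. fact (card {b\<in>insert x S. f b = c}))"
    by (rule prod.remove[OF assms(2) x, symmetric])
  finally show ?case .
qed

subsection \<open>Separated products\<close>

lemma ncycle_inv:
  assumes "finite S" "ncycle S \<sigma>"
  shows "ncycle S (inv \<sigma>)"
  using assms orbit_inv_eq[OF permutes_imp_permutation[OF assms(1)]]
  by (auto simp: ncycle_def cyclic_on_alldef permutes_inv)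

lemma orbits_monochromatic_iff:
  assumes "finite S" "\<pi> permutes S"
  shows "(\<forall>C\<in>orbit \<pi> ` S. \<forall>u\<in>C. \<forall>v\<in>C. f u = f v) \<longleftrightarrow> \<pi> \<in> stab S f"
proof
  assume R: "\<forall>C\<in>orbit \<pi> ` S. \<forall>u\<in>C. \<forall>v\<in>C. f u = f v"
  have "f (\<pi> x) = f x" if "x \<in> S" for x
    using R that permutation_self_in_orbit[OF permutes_imp_permutation[OF assms], of x]
      orbit.base[of \<pi> x] by blast
  then show "\<pi> \<in> stab S f" using assms by (simp add: stab_def)
next
  assume "\<pi> \<in> stab S f"
  then have st: "\<And>x. x \<in> S \<Longrightarrow> f (\<pi> x) = f x" by (simp add: stab_def)
  have "f z = f x \<and> z \<in> S" if "x \<in> S" "z \<in> orbit \<pi> x" for x z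
    using that(2,1) by induction (auto simp: st permutes_in_image[OF assms(2)])
  then show "\<forall>C\<in>orbit \<pi> ` S. \<forall>u\<in>C. \<forall>v\<in>C. f u = f v" by fastforce
qed

text \<open>A pair is encoded by its product \<open>w\<close> and the inverse \<open>\<rho>\<close>
  of its first factor; the second factor is then \<open>\<rho> \<circ> w\<close>, which matches the
  form of \<open>nfact\<close>.\<close>

lemma card_separated_pairs:
  assumes "finite S"
  shows "card {(\<sigma>, \<tau>). ncycle S \<sigma> \<and> ncycle S \<tau> \<and>
      (\<forall>C\<in>orbit (\<sigma> \<circ> \<tau>) ` S. \<forall>u\<in>C. \<forall>v\<in>C. f u = f v)} = sepcount S f"
proof -
  let ?P = "{(\<sigma>, \<tau>). ncycle S \<sigma> \<and> ncycle S \<tau> \<and> \<sigma> \<circ> \<tau> \<in> stab S f}"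
  let ?Q = "Sigma (stab S f) (\<lambda>w. {\<rho>. ncycle S \<rho> \<and> ncycle S (\<rho> \<circ> w)})"
  have "{(\<sigma>, \<tau>). ncycle S \<sigma> \<and> ncycle S \<tau> \<and>
      (\<forall>C\<in>orbit (\<sigma> \<circ> \<tau>) ` S. \<forall>u\<in>C. \<forall>v\<in>C. f u = f v)} = ?P"
    using orbits_monochromatic_iff[OF assms permutes_compose] ncycle_permutes by blast
  moreover have "bij_betw (\<lambda>(\<sigma>, \<tau>). (\<sigma> \<circ> \<tau>, inv \<sigma>)) ?P ?Q"
  proof (rule bij_betwI[where g = "\<lambda>(w, \<rho>). (inv \<rho>, \<rho> \<circ> w)"])
    have a: "inv \<sigma> \<circ> (\<sigma> \<circ> \<tau>) = \<tau>" "\<sigma> \<circ> (inv \<sigma> \<circ> \<tau>) = \<tau>" "inv (inv \<sigma>) = \<sigma>"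
      if "ncycle S \<sigma>" for \<sigma> \<tau> :: "'a \<Rightarrow> 'a"
      using permutes_inv_o[OF ncycle_permutes[OF that]] permutes_inv_inv[OF ncycle_permutes[OF that]]
      by (simp_all add: comp_assoc[symmetric])
    show "(\<lambda>(\<sigma>, \<tau>). (\<sigma> \<circ> \<tau>, inv \<sigma>)) \<in> ?P \<rightarrow> ?Q"
      by (auto simp: ncycle_inv[OF assms] a)
    show "(\<lambda>(w, \<rho>). (inv \<rho>, \<rho> \<circ> w)) \<in> ?Q \<rightarrow> ?P"
      using a[OF ncycle_inv[OF assms]] by (auto simp: ncycle_inv[OF assms] a)
    show "(case (case p of (\<sigma>, \<tau>) \<Rightarrow> (\<sigma> \<circ> \<tau>, inv \<sigma>)) of (w, \<rho>) \<Rightarrow> (inv \<rho>, \<rho> \<circ> w)) = p" if "p \<in> ?P" for p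
      using that by (auto simp: a)
    show "(case (case p of (w, \<rho>) \<Rightarrow> (inv \<rho>, \<rho> \<circ> w)) of (\<sigma>, \<tau>) \<Rightarrow> (\<sigma> \<circ> \<tau>, inv \<sigma>)) = p" if "p \<in> ?Q" for p
      using that by (auto simp: a)
  qed
  ultimately have "card {(\<sigma>, \<tau>). ncycle S \<sigma> \<and> ncycle S \<tau> \<and>
      (\<forall>C\<in>orbit (\<sigma> \<circ> \<tau>) ` S. \<forall>u\<in>C. \<forall>v\<in>C. f u = f v)} = card ?Q"
    using bij_betw_same_card by simp
  also have "\<dots> = sepcount S f"
    unfolding sepcount_def nfact_def using assms finite_stab[OF assms] by (intro card_SigmaI) auto
  finally show ?thesis .
qed

lemma full_cycle_iff_ncycle: "full_cycle n \<sigma> \<longleftrightarrow> ncycle {1..n} \<sigma>"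
  by (simp add: full_cycle_def ncycle_def)

text \<open>Common source of both claims: \<open>P\<close> stands for either separation condition,
  and \<open>f\<close> for the colouring that describes it.\<close>

lemma separated_pairs_formula:
  fixes f :: "nat \<Rightarrow> 'b"
  assumes "1 \<le> n"
    and "\<And>\<pi>. \<pi> permutes {1..n} \<Longrightarrow>
      P \<pi> \<longleftrightarrow> (\<forall>C\<in>cycle_sets n \<pi>. \<forall>u\<in>C. \<forall>v\<in>C. f u = f v)"
  shows "real (card {(\<sigma>, \<tau>). full_cycle n \<sigma> \<and> full_cycle n \<tau> \<and> P (\<sigma> \<circ> \<tau>)}) *
      (real n + 1 - real (card (f ` {1..n}))) =
    fact (n - 1) * (\<Prod>c\<in>f ` {1..n}. fact (card {x\<in>{1..n}. f x = c}))"
proof -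
  have "P (\<sigma> \<circ> \<tau>) \<longleftrightarrow> (\<forall>C\<in>orbit (\<sigma> \<circ> \<tau>) ` {1..n}. \<forall>u\<in>C. \<forall>v\<in>C. f u = f v)"
    if "ncycle {1..n} \<sigma>" "ncycle {1..n} \<tau>" for \<sigma> \<tau>
    using assms(2)[OF permutes_compose[OF ncycle_permutes[OF that(2)] ncycle_permutes[OF that(1)]]]
    by (simp add: cycle_sets_def)
  then have "{(\<sigma>, \<tau>). full_cycle n \<sigma> \<and> full_cycle n \<tau> \<and> P (\<sigma> \<circ> \<tau>)} =
      {(\<sigma>, \<tau>). ncycle {1..n} \<sigma> \<and> ncycle {1..n} \<tau> \<and>
        (\<forall>C\<in>orbit (\<sigma> \<circ> \<tau>) ` {1..n}. \<forall>u\<in>C. \<forall>v\<in>C. f u = f v)}"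
    unfolding full_cycle_iff_ncycle by blast
  then have "card {(\<sigma>, \<tau>). full_cycle n \<sigma> \<and> full_cycle n \<tau> \<and> P (\<sigma> \<circ> \<tau>)} = sepcount {1..n} f"
    by (simp only: card_separated_pairs[OF finite_atLeastAtMost])
  moreover have "real (sepcount {1..n} f) * (real n + 1 - real (card (f ` {1..n}))) =
      fact (n - 1) * real (card (stab {1..n} f))"
    using sepcount_formula[OF infinite_UNIV_nat, of "{1..n}" 1 f "f 1"] assms(1) by simp
  ultimately show ?thesis
    using card_stab[of "{1..n}" "f ` {1..n}" f] by simp
qed

section \<open>Blocks of a composition\<close>

lemma sum_list_take_Suc:
  "i < length \<alpha> \<Longrightarrow> sum_list (take (Suc i) \<alpha>) = sum_list (take i \<alpha>) + (\<alpha> ! i :: nat)"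
  by (simp add: take_Suc_conv_app_nth)

lemma sum_list_take_mono:
  assumes "i \<le> j"
  shows "sum_list (take i \<alpha>) \<le> (sum_list (take j \<alpha>) :: nat)"
proof -
  have "take j \<alpha> = take i \<alpha> @ take (j - i) (drop i \<alpha>)"
    using take_add[of i "j - i" \<alpha>] assms by simp
  then show ?thesis by simp
qed

lemma block_inj:
  assumes "x \<in> block \<alpha> i" "x \<in> block \<alpha> j" "i < length \<alpha>" "j < length \<alpha>"
  shows "i = j"
proof -
  have False if "x \<in> block \<alpha> i" "x \<in> block \<alpha> j" "i < length \<alpha>" "i < j" for i j
    using that sum_list_take_mono[of "Suc i" j \<alpha>] sum_list_take_Suc[of i \<alpha>]
    by (simp add: block_def)
  then show ?thesis using assms by (metis nat_neq_iff)
qed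

lemma block_cover: "x \<in> {1..sum_list \<alpha>} \<Longrightarrow> \<exists>i<length \<alpha>. x \<in> block \<alpha> i"
proof -
  assume x: "x \<in> {1..sum_list \<alpha>}"
  \<comment> \<open>\<open>i\<close> counts the parts needed to reach \<open>x\<close>. It is
    positive as \<open>x \<ge> 1\<close>, and with indices from 0 the block of \<open>x\<close> is
    the one before \<open>i\<close>.\<close>
  define i where "i = (LEAST j. x \<le> sum_list (take j \<alpha>))"
  have i: "x \<le> sum_list (take i \<alpha>)" "i \<le> length \<alpha>"
    unfolding i_def using x by (auto intro: LeastI[of _ "length \<alpha>"] Least_le)
  then have "i \<noteq> 0" using x by (intro notI) simp
  then obtain j where j: "i = Suc j" using not0_implies_Suc by blast
  then have "\<not> x \<le> sum_list (take j \<alpha>)" unfolding i_def by (intro not_less_Least) simp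
  then have "x \<in> block \<alpha> j" using i j sum_list_take_Suc[of j \<alpha>] by (simp add: block_def)
  moreover have "j < length \<alpha>" using i j by simp
  ultimately show ?thesis by blast
qed

theorem theorem1p4:
  "(\<forall>n k :: nat. 2 \<le> n \<and> 1 \<le> k \<and> k \<le> n - 1 \<longrightarrow>
      card {(\<sigma>, \<tau>). full_cycle n \<sigma> \<and> full_cycle n \<tau> \<and>
              \<not> (\<exists>C\<in>cycle_sets n (\<sigma> \<circ> \<tau>). C \<inter> {1..k} \<noteq> {} \<and> C \<inter> ({1..n} - {1..k}) \<noteq> {})}
        = fact k * fact (n - k) * fact (n - 2)) \<and>
   (\<forall>(n :: nat) (\<alpha> :: nat list). 1 \<le> n \<and> is_composition \<alpha> n \<longrightarrow>
      real (card {(\<sigma>, \<tau>). full_cycle n \<sigma> \<and> full_cycle n \<tau> \<and> separated n \<alpha> (\<sigma> \<circ> \<tau>)})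
        = fact (n - 1) / (real n + 1 - real (length \<alpha>)) * (\<Prod>t<length \<alpha>. fact (\<alpha> ! t)))"
proof (intro conjI allI impI)
  fix n k :: nat
  assume nk: "2 \<le> n \<and> 1 \<le> k \<and> k \<le> n - 1"
  let ?P = "\<lambda>\<pi>. \<not> (\<exists>C\<in>cycle_sets n \<pi>. C \<inter> {1..k} \<noteq> {} \<and> C \<inter> ({1..n} - {1..k}) \<noteq> {})"
  let ?f = "\<lambda>x. x \<le> k"
  let ?N = "card {(\<sigma>, \<tau>). full_cycle n \<sigma> \<and> full_cycle n \<tau> \<and> ?P (\<sigma> \<circ> \<tau>)}"
  have eq: "?P \<pi> \<longleftrightarrow> (\<forall>C\<in>cycle_sets n \<pi>. \<forall>u\<in>C. \<forall>v\<in>C. ?f u = ?f v)"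
    if "\<pi> permutes {1..n}" for \<pi>
  proof -
    have "(C \<inter> {1..k} \<noteq> {} \<and> C \<inter> ({1..n} - {1..k}) \<noteq> {}) \<longleftrightarrow> \<not> (\<forall>u\<in>C. \<forall>v\<in>C. ?f u = ?f v)"
      if "C \<in> cycle_sets n \<pi>" for C
    proof -
      have "C \<subseteq> {1..n}"
        using that permutes_orbit_subset[OF \<open>\<pi> permutes {1..n}\<close>] unfolding cycle_sets_def by blast
      then show ?thesis by fastforce
    qed
    then show ?thesis by blast
  qed
  have im: "?f ` {1..n} = {True, False}"
  proof -
    have "True \<in> ?f ` {1..n}" using nk by (intro image_eqI[of _ _ 1]) auto
    moreover have "False \<in> ?f ` {1..n}" using nk by (intro image_eqI[of _ _ n]) auto
    ultimately show ?thesis by blast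
  qed
  have "{x\<in>{1..n}. x \<le> k} = {1..k}" "{x\<in>{1..n}. \<not> x \<le> k} = {k+1..n}" using nk by auto
  then have cards: "card {x\<in>{1..n}. x \<le> k} = k" "card {x\<in>{1..n}. \<not> x \<le> k} = n - k" by simp_all
  have "real ?N * (real n + 1 - real (card (?f ` {1..n}))) =
      fact (n - 1) * (\<Prod>c\<in>?f ` {1..n}. fact (card {x\<in>{1..n}. ?f x = c}))"
    by (rule separated_pairs_formula[where P = ?P]) (use nk eq in auto)
  \<comment> \<open>Two colours occur, so the factor is \<open>n + 1 - 2\<close>. It is nonzero and
    cancels one factor of \<open>fact (n - 1)\<close>.\<close>
  then have "real ?N * (real n - 1) = fact (n - 1) * (fact k * fact (n - k))"
    unfolding im using cards by simp
  moreover have "fact (n - 1) = (real n - 1) * fact (n - 2)"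
  proof -
    obtain m where "n = Suc (Suc m)" using nk by (metis Suc_le_D numeral_2_eq_2 Suc_le_mono)
    then show ?thesis by (simp add: algebra_simps)
  qed
  ultimately have "(real n - 1) * real ?N = (real n - 1) * real (fact k * fact (n - k) * fact (n - 2))"
    by (simp add: mult_ac)
  then have "real ?N = real (fact k * fact (n - k) * fact (n - 2))"
    using nk by simp
  then show "?N = fact k * fact (n - k) * fact (n - 2)" by (simp only: of_nat_eq_iff)
next
  fix n :: nat and \<alpha> :: "nat list"
  assume "1 \<le> n \<and> is_composition \<alpha> n"
  then have n: "1 \<le> n" "sum_list \<alpha> = n" and pos: "\<And>i. i < length \<alpha> \<Longrightarrow> 0 < \<alpha> ! i"
    by (auto simp: is_composition_def)
  let ?N = "card {(\<sigma>, \<tau>). full_cycle n \<sigma> \<and> full_cycle n \<tau> \<and> separated n \<alpha> (\<sigma> \<circ> \<tau>)}"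
  \<comment> \<open>The colour of a point is the index of its block; outside [n] the value is
    unspecified.\<close>
  define f where "f x = (THE i. i < length \<alpha> \<and> x \<in> block \<alpha> i)" for x
  have f_eq: "f x = i" if "i < length \<alpha>" "x \<in> block \<alpha> i" for x i
    unfolding f_def using that block_inj by blast
  have f_in: "f x < length \<alpha>" "x \<in> block \<alpha> (f x)" if "x \<in> {1..n}" for x
    using block_cover[of x \<alpha>] that f_eq n by auto
  have sub: "block \<alpha> i \<subseteq> {1..n}" if "i < length \<alpha>" for i
    using sum_list_take_mono[of "Suc i" "length \<alpha>" \<alpha>] sum_list_take_Suc[OF that] that n
    by (auto simp: block_def)
  have fib: "{x\<in>{1..n}. f x = i} = block \<alpha> i" if "i < length \<alpha>" for i
    using f_eq[OF that] f_in sub[OF that] by auto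
  have cb: "card (block \<alpha> i) = \<alpha> ! i" for i by (simp add: block_def)
  \<comment> \<open>Positive parts make every block nonempty, so the number of colours is exactly
    the number of parts.\<close>
  have im: "f ` {1..n} = {..<length \<alpha>}"
  proof
    show "f ` {1..n} \<subseteq> {..<length \<alpha>}" using f_in by auto
    show "{..<length \<alpha>} \<subseteq> f ` {1..n}"
    proof
      fix i assume "i \<in> {..<length \<alpha>}"
      then have i: "i < length \<alpha>" by simp
      have "block \<alpha> i \<noteq> {}" using cb[of i] pos[OF i] by (metis card.empty less_numeral_extra(3))
      then obtain x where "x \<in> {x\<in>{1..n}. f x = i}" unfolding fib[OF i] by blast
      then show "i \<in> f ` {1..n}" by (intro image_eqI[of _ _ x]) auto
    qed
  qed
  have eq: "separated n \<alpha> \<pi> \<longleftrightarrow> (\<forall>C\<in>cycle_sets n \<pi>. \<forall>u\<in>C. \<forall>v\<in>C. f u = f v)"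
    if "\<pi> permutes {1..n}" for \<pi>
  proof -
    have "(\<exists>i<length \<alpha>. C \<subseteq> block \<alpha> i) \<longleftrightarrow> (\<forall>u\<in>C. \<forall>v\<in>C. f u = f v)"
      if C: "C \<in> cycle_sets n \<pi>" for C
    proof
      assume "\<exists>i<length \<alpha>. C \<subseteq> block \<alpha> i"
      then obtain i where "i < length \<alpha>" "C \<subseteq> block \<alpha> i" by blast
      then have "f u = i" if "u \<in> C" for u using f_eq that by blast
      then show "\<forall>u\<in>C. \<forall>v\<in>C. f u = f v" by simp
    next
      assume R: "\<forall>u\<in>C. \<forall>v\<in>C. f u = f v"
      have C': "C \<subseteq> {1..n}" "C \<noteq> {}"
        using C permutes_orbit_subset[OF \<open>\<pi> permutes {1..n}\<close>] orbit_nonempty[of \<pi>]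
        unfolding cycle_sets_def by blast+
      then obtain u where u: "u \<in> C" by blast
      have "C \<subseteq> block \<alpha> (f u)"
      proof
        fix v assume "v \<in> C"
        then have "v \<in> {1..n}" "f v = f u" using R u C' by blast+
        then show "v \<in> block \<alpha> (f u)" using f_in(2)[of v] by simp
      qed
      then show "\<exists>i<length \<alpha>. C \<subseteq> block \<alpha> i" using u C' f_in by blast
    qed
    then show ?thesis by (simp add: separated_def)
  qed
  \<comment> \<open>There are at most as many colours as points, so the denominator is
    nonzero.\<close>
  have "length \<alpha> \<le> n" using card_image_le[of "{1..n}" f] im by simp
  then have nz: "real n + 1 - real (length \<alpha>) \<noteq> 0" by linarith
  have "real ?N * (real n + 1 - real (card (f ` {1..n}))) =
      fact (n - 1) * (\<Prod>c\<in>f ` {1..n}. fact (card {x\<in>{1..n}. f x = c}))"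
    by (rule separated_pairs_formula[OF n(1) eq])
  also have "(\<Prod>c\<in>f ` {1..n}. fact (card {x\<in>{1..n}. f x = c})) = (\<Prod>t<length \<alpha>. fact (\<alpha> ! t) :: real)"
    unfolding im by (rule prod.cong[OF refl]) (simp only: lessThan_iff fib cb)
  finally have "real ?N * (real n + 1 - real (length \<alpha>)) = fact (n - 1) * (\<Prod>t<length \<alpha>. fact (\<alpha> ! t))"
    by (simp only: im card_lessThan)
  then show "real ?N = fact (n - 1) / (real n + 1 - real (length \<alpha>)) * (\<Prod>t<length \<alpha>. fact (\<alpha> ! t))"
    using nz by (simp add: field_simps)
qed

end
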